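(* Let $X_1$ and $X_2$ be two independent, centered, unit-variance real random variables with finite fourth moments $m_i = \mathbb{E}[X_i^4]$, $i = 1,2$. Assume that $m_1 \ne 3$ or $m_2 \ne 3$. Let $(\alpha,\beta) \in \mathbb{R}^2$ with $(\alpha,\beta) \ne (0,0)$, let $Y_0 \overset{d}{=} \alpha X_1 + \beta X_2$, and let $Y_u = \alpha_u X_1 + \beta_u X_2$, where $(\alpha_u,\beta_u) = (\alpha,\beta)/\|(\alpha,\beta)\|_2$. Let $\mathcal{B}_0 = \{(a,b) \in \mathbb{R}^2 : a X_1 + b X_2 \overset{d}{=} Y_0\}$ and define $$c := \mathbb{E}[Y_u^4] = \alpha_u^4 m_1 + \beta_u^4 m_2 + 6 \alpha_u^2 \beta_u^2.$$ Then: (1) If $c = 3$, then $\mathcal{B}_0 \subseteq \{(\sigma\alpha, \tau\beta) : \sigma \in \{-1,1\},\ \tau \in \{-1,1\}\}$. (2) If $c \ne 3$, then $|\mathcal{B}_0| \le 8$. Moreover, setting $$w_1 = \frac{m_1 - 3}{c - 3}, \qquad w_2 = \frac{m_2 - 3}{c - 3},$$ if $\min\{w_1,w_2\} < 1$, then $\mathcal{B}_0 \subseteq \{(\sigma\alpha, \tau\beta) : \sigma \in \{-1,1\},\ \tau \in \{-1,1\}\}$.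
   Context: $\overset{d}{=}$ denotes equality in distribution; $\|\cdot\|_2$ is the Euclidean norm; $|\mathcal{B}_0|$ is the cardinality of $\mathcal{B}_0$. *)

theory Defs
  imports "HOL-Probability.Probability"
begin

definition eq_in_distr ::
  "'a measure \<Rightarrow> ('a \<Rightarrow> real) \<Rightarrow> 'b measure \<Rightarrow> ('b \<Rightarrow> real) \<Rightarrow> bool" where
  "eq_in_distr M X N Y \<longleftrightarrow>
     X \<in> borel_measurable M \<and> Y \<in> borel_measurable N \<and> distr M borel X = distr N borel Y"

definition repr_coeffs ::
  "'a measure \<Rightarrow> ('a \<Rightarrow> real) \<Rightarrow> ('a \<Rightarrow> real) \<Rightarrow> 'b measure \<Rightarrow> ('b \<Rightarrow> real) \<Rightarrow> (real \<times> real) set" where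
  "repr_coeffs M X\<^sub>1 X\<^sub>2 N Y = {(a, b). eq_in_distr M (\<lambda>\<omega>. a * X\<^sub>1 \<omega> + b * X\<^sub>2 \<omega>) N Y}"

definition sign_changes :: "real \<Rightarrow> real \<Rightarrow> (real \<times> real) set" where
  "sign_changes \<alpha> \<beta> = {(\<sigma> * \<alpha>, \<tau> * \<beta>) | \<sigma> \<tau>. \<sigma> \<in> {-1, 1} \<and> \<tau> \<in> {-1, 1}}"

end

theory Submission
  imports Defs
begin

text \<open>
  Equality in distribution preserves the second and fourth moments. With \<open>k\<^sub>i = m\<^sub>i - 3\<close>, both
  \<open>(A, B) = (a\<^sup>2, b\<^sup>2)\<close> and \<open>(P, Q) = (\<alpha>\<^sup>2, \<beta>\<^sup>2)\<close> therefore lie on one line \<open>A + B = s\<close> and on one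
  conic \<open>A\<^sup>2 k\<^sub>1 + B\<^sup>2 k\<^sub>2 = s\<^sup>2 (c - 3)\<close>. If the two points differ, dividing by \<open>A - P = Q - B\<close> gives
  \<open>(A + P) k\<^sub>1 = (B + Q) k\<^sub>2\<close>, so at most one second point exists. This makes \<open>(k\<^sub>1, k\<^sub>2)\<close>
  proportional to \<open>(B + Q, A + P)\<close>, which forces \<open>c \<noteq> 3\<close> and \<open>w\<^sub>1, w\<^sub>2 \<ge> 1\<close>.
\<close>

section \<open>Moments of linear combinations of independent variables\<close>

text \<open>For even \<open>n\<close>, \<open>\<bar>t\<bar> ^ k\<close> is at most 1 on [-1, 1] and
  at most \<open>t ^ n\<close> elsewhere, so \<open>1 + t ^ n\<close> dominates it; the constant 1
  is integrable because the measure is finite.\<close>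

lemma integrable_power_le:
  fixes X :: "'a \<Rightarrow> real"
  assumes "prob_space M" and X: "X \<in> borel_measurable M"
    and int: "integrable M (\<lambda>x. X x ^ n)" and "even n" and "k \<le> n"
  shows "integrable M (\<lambda>x. X x ^ k)"
proof -
  interpret prob_space M by fact
  have "\<bar>t\<bar> ^ k \<le> 1 + t ^ n" for t :: real
  proof (cases "\<bar>t\<bar> \<le> 1")
    case True
    then have "\<bar>t\<bar> ^ k \<le> 1" by (simp add: power_le_one)
    then show ?thesis using zero_le_even_power[OF \<open>even n\<close>, of t] by linarith
  next
    case False
    then have "\<bar>t\<bar> ^ k \<le> \<bar>t\<bar> ^ n" using \<open>k \<le> n\<close> by (intro power_increasing) auto
    also have "\<bar>t\<bar> ^ n = t ^ n" using \<open>even n\<close> by (rule power_even_abs)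
    finally show ?thesis by simp
  qed
  moreover have "1 + t ^ n = \<bar>1 + t ^ n\<bar>" for t :: real
    using zero_le_even_power[OF \<open>even n\<close>, of t] by simp
  ultimately have "norm (X x ^ k) \<le> norm (1 + X x ^ n)" for x
    by (metis power_abs real_norm_def)
  then have "AE x in M. norm (X x ^ k) \<le> norm (1 + X x ^ n)"
    by simp
  moreover have "integrable M (\<lambda>x. 1 + X x ^ n)"
    using int by simp
  moreover have "(\<lambda>x. X x ^ k) \<in> borel_measurable M"
    using X by measurable
  ultimately show ?thesis
    by (rule Bochner_Integration.integrable_bound[rotated 2])
qed

lemma (in prob_space) indep_var_power_mult:
  fixes X Y :: "'a \<Rightarrow> real"
  assumes ind: "indep_var borel X borel Y"
    and "integrable M (\<lambda>x. X x ^ i)" and "integrable M (\<lambda>x. Y x ^ j)"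
  shows "integrable M (\<lambda>x. X x ^ i * Y x ^ j)"
    and "expectation (\<lambda>x. X x ^ i * Y x ^ j) = expectation (\<lambda>x. X x ^ i) * expectation (\<lambda>x. Y x ^ j)"
proof -
  have "indep_var borel ((\<lambda>t. t ^ i) \<circ> X) borel ((\<lambda>t. t ^ j) \<circ> Y)"
    using ind by (rule indep_var_compose) auto
  then have ij: "indep_var borel (\<lambda>x. X x ^ i) borel (\<lambda>x. Y x ^ j)"
    by (simp add: comp_def)
  show "integrable M (\<lambda>x. X x ^ i * Y x ^ j)"
    using ij assms(2,3) by (rule indep_var_integrable)
  show "expectation (\<lambda>x. X x ^ i * Y x ^ j) = expectation (\<lambda>x. X x ^ i) * expectation (\<lambda>x. Y x ^ j)"
    using ij assms(2,3) by (rule indep_var_lebesgue_integral)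
qed

text \<open>Expand binomially and factor each mixed moment by independence. Every term with an odd
  exponent on both variables contains a vanishing mean, so the third moments never enter; the
  coefficient 6 is \<open>4 choose 2\<close>.\<close>

lemma (in prob_space) moments_linear_combination:
  fixes X Y :: "'a \<Rightarrow> real"
  assumes ind: "indep_var borel X borel Y"
    and X1: "expectation X = 0" and Y1: "expectation Y = 0"
    and "variance X = 1" and "variance Y = 1"
    and X4: "integrable M (\<lambda>x. X x ^ 4)" and Y4: "integrable M (\<lambda>x. Y x ^ 4)"
  shows "expectation (\<lambda>x. (a * X x + b * Y x)\<^sup>2) = a\<^sup>2 + b\<^sup>2"
    and "expectation (\<lambda>x. (a * X x + b * Y x) ^ 4) =
      a ^ 4 * expectation (\<lambda>x. X x ^ 4) + b ^ 4 * expectation (\<lambda>x. Y x ^ 4) + 6 * a\<^sup>2 * b\<^sup>2"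
proof -
  have X2: "expectation (\<lambda>x. (X x)\<^sup>2) = 1" and Y2: "expectation (\<lambda>x. (Y x)\<^sup>2) = 1"
    using assms(2-5) by simp_all
  have "X \<in> borel_measurable M" "Y \<in> borel_measurable M"
    using ind indep_var_rv1 indep_var_rv2 by blast+
  then have iX: "integrable M (\<lambda>x. X x ^ k)" and iY: "integrable M (\<lambda>x. Y x ^ k)" if "k \<le> 4" for k
    using integrable_power_le[OF prob_space_axioms _ X4 _ that]
      integrable_power_le[OF prob_space_axioms _ Y4 _ that] by simp_all
  have prod: "integrable M (\<lambda>x. X x ^ i * Y x ^ j)"
      "expectation (\<lambda>x. X x ^ i * Y x ^ j) = expectation (\<lambda>x. X x ^ i) * expectation (\<lambda>x. Y x ^ j)"
    if "i \<le> 4" "j \<le> 4" for i j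
    using indep_var_power_mult[OF ind iX iY] that by auto
  have binom: "expectation (\<lambda>x. (a * X x + b * Y x) ^ n) =
      (\<Sum>k\<le>n. of_nat (n choose k) * a ^ k * b ^ (n - k) *
        (expectation (\<lambda>x. X x ^ k) * expectation (\<lambda>x. Y x ^ (n - k))))" if "n \<le> 4" for n
  proof -
    have "expectation (\<lambda>x. (a * X x + b * Y x) ^ n) =
      expectation (\<lambda>x. \<Sum>k\<le>n. of_nat (n choose k) * a ^ k * b ^ (n - k) * (X x ^ k * Y x ^ (n - k)))"
      by (simp add: binomial_ring power_mult_distrib mult_ac)
    also have "\<dots> = (\<Sum>k\<le>n. of_nat (n choose k) * a ^ k * b ^ (n - k) *
        expectation (\<lambda>x. X x ^ k * Y x ^ (n - k)))"
      using prod(1) that by (subst Bochner_Integration.integral_sum) auto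
    finally show ?thesis using prod(2) that by simp
  qed
  have sum2: "(\<Sum>k\<le>2. f k) = f 0 + f 1 + f 2" for f :: "nat \<Rightarrow> real"
    by (simp add: numeral_eq_Suc)
  have sum4: "(\<Sum>k\<le>4. f k) = f 0 + f 1 + f 2 + f 3 + f 4" for f :: "nat \<Rightarrow> real"
    by (simp add: numeral_eq_Suc)
  have choose: "(4::nat) choose 2 = 6"
    by (simp add: numeral_eq_Suc)
  show "expectation (\<lambda>x. (a * X x + b * Y x)\<^sup>2) = a\<^sup>2 + b\<^sup>2"
    unfolding binom[of 2, simplified] sum2 by (simp add: X1 Y1 X2 Y2 prob_space)
  show "expectation (\<lambda>x. (a * X x + b * Y x) ^ 4) =
      a ^ 4 * expectation (\<lambda>x. X x ^ 4) + b ^ 4 * expectation (\<lambda>x. Y x ^ 4) + 6 * a\<^sup>2 * b\<^sup>2"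
    unfolding binom[of 4, simplified] sum4 by (simp add: X1 Y1 X2 Y2 prob_space choose)
qed

lemma eq_in_distr_expectation:
  fixes g :: "real \<Rightarrow> real"
  assumes "eq_in_distr M X N Y" and "g \<in> borel_measurable borel"
  shows "(\<integral>x. g (X x) \<partial>M) = (\<integral>y. g (Y y) \<partial>N)"
proof -
  have X: "X \<in> borel_measurable M" and Y: "Y \<in> borel_measurable N"
    and eq: "distr M borel X = distr N borel Y"
    using assms(1) by (simp_all add: eq_in_distr_def)
  show ?thesis
    using integral_distr[OF X assms(2)] integral_distr[OF Y assms(2)] eq by simp
qed

lemma eq_in_distr_trans:
  "eq_in_distr M X N Y \<Longrightarrow> eq_in_distr N Y L Z \<Longrightarrow> eq_in_distr M X L Z"
  by (simp add: eq_in_distr_def)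

section \<open>Points with the same squared coordinates\<close>

lemma sign_changes_eq: "sign_changes \<alpha> \<beta> = {(\<alpha>, \<beta>), (\<alpha>, - \<beta>), (- \<alpha>, \<beta>), (- \<alpha>, - \<beta>)}"
proof -
  have "sign_changes \<alpha> \<beta> = (\<Union>\<sigma>\<in>{-1, 1}. \<Union>\<tau>\<in>{-1, 1}. {(\<sigma> * \<alpha>, \<tau> * \<beta>)})"
    unfolding sign_changes_def by blast
  then show ?thesis by auto
qed

text \<open>Signs disappear on passing to squares, the coordinates in which the moment equations
  become a line and a conic.\<close>

lemma mem_sign_changes_iff: "(a, b) \<in> sign_changes \<alpha> \<beta> \<longleftrightarrow> a\<^sup>2 = \<alpha>\<^sup>2 \<and> b\<^sup>2 = \<beta>\<^sup>2"
  by (auto simp: sign_changes_eq power2_eq_iff)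

lemma finite_sign_changes: "finite (sign_changes \<alpha> \<beta>)"
  by (simp add: sign_changes_eq)

lemma card_sign_changes_le: "card (sign_changes \<alpha> \<beta>) \<le> 4"
  using card_length[of "[(\<alpha>, \<beta>), (\<alpha>, - \<beta>), (- \<alpha>, \<beta>), (- \<alpha>, - \<beta>)]"]
  by (simp add: sign_changes_eq)

section \<open>Intersections of a line and a conic\<close>

lemma line_conic_second_point:
  fixes A B P Q k l :: real
  assumes line: "A + B = P + Q"
    and conic: "A\<^sup>2 * k + B\<^sup>2 * l = P\<^sup>2 * k + Q\<^sup>2 * l"
    and "A \<noteq> P"
  shows "(A + P) * k = (B + Q) * l"
proof -
  have B: "B = P + Q - A" using line by simp
  have "(A - P) * ((A + P) * k - (B + Q) * l) = 0"
    using conic unfolding B by algebra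
  then show ?thesis using \<open>A \<noteq> P\<close> by simp
qed

text \<open>On the line, the relation for a second point is linear in \<open>A\<close> with slope
  \<open>k + l\<close>. Two different solutions force \<open>l = - k\<close>, and then the relation
  reads \<open>2 * (P + Q) * k = 0\<close>, so both \<open>k\<close> and \<open>l\<close>
  vanish.\<close>

lemma line_conic_three_points:
  fixes A B A' B' P Q k l :: real
  assumes "A + B = P + Q" and "A' + B' = P + Q" and "P + Q \<noteq> 0"
    and "A\<^sup>2 * k + B\<^sup>2 * l = P\<^sup>2 * k + Q\<^sup>2 * l" and "A'\<^sup>2 * k + B'\<^sup>2 * l = P\<^sup>2 * k + Q\<^sup>2 * l"
    and "A \<noteq> P" and "A' \<noteq> P" and "k \<noteq> 0 \<or> l \<noteq> 0"
  shows "A = A'"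
proof (rule ccontr)
  assume "A \<noteq> A'"
  have 1: "(A + P) * k = (B + Q) * l" and 2: "(A' + P) * k = (B' + Q) * l"
    using assms line_conic_second_point by blast+
  have "B' = P + Q - A'" "B = P + Q - A" using assms(1,2) by simp_all
  then have "(A - A') * (k + l) = 0" using 1 2 by algebra
  then have "l = - k" using \<open>A \<noteq> A'\<close> by simp
  then have "(A + B + P + Q) * k = 0" using 1 by algebra
  then show False using assms(1,3,8) \<open>l = - k\<close> by simp
qed

lemma line_conic_weights:
  fixes A B P Q k l C :: real
  assumes nonneg: "0 \<le> A" "0 \<le> B" "0 \<le> P" "0 \<le> Q"
    and line: "A + B = P + Q" and "0 < P + Q"
    and conic: "A\<^sup>2 * k + B\<^sup>2 * l = P\<^sup>2 * k + Q\<^sup>2 * l"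
    and C: "P\<^sup>2 * k + Q\<^sup>2 * l = (P + Q)\<^sup>2 * C"
    and "A \<noteq> P" and nz: "k \<noteq> 0 \<or> l \<noteq> 0"
  shows "C \<noteq> 0" and "1 \<le> k / C" and "1 \<le> l / C"
proof -
  \<comment> \<open>From \<open>x * k = y * l\<close> the pair \<open>(k, l)\<close> is a multiple
    \<open>r\<close> of \<open>(y, x)\<close>; adding the components and using
    \<open>x + y = 2 * s\<close> gives the value of \<open>r\<close>.\<close>
  define s x y r where "s = P + Q" and "x = A + P" and "y = B + Q" and "r = (k + l) / (2 * s)"
  have "s > 0" using assms(6) by (simp add: s_def)
  have eq: "x * k = y * l" using line_conic_second_point[OF line conic \<open>A \<noteq> P\<close>] by (simp add: x_def y_def)
  have xy: "x + y = 2 * s" using line by (simp add: x_def y_def s_def)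
  have "2 * s * k = (k + l) * y" "2 * s * l = (k + l) * x" using eq xy by algebra+
  then have k: "k = r * y" and l: "l = r * x" using \<open>s > 0\<close> by (simp_all add: r_def field_simps)
  define D where "D = P\<^sup>2 * y + Q\<^sup>2 * x"
  have sC: "s\<^sup>2 * C = r * D" using C k l by (simp add: s_def D_def algebra_simps)
  have "r \<noteq> 0" using nz k l by auto
  \<comment> \<open>A sum of two nonnegative numbers vanishes only if both do; either
    \<open>A = P = 0\<close> or \<open>B = Q = 0\<close> would contradict
    \<open>A \<noteq> P\<close>.\<close>
  have pos: "x > 0" "y > 0" using nonneg line \<open>A \<noteq> P\<close> by (simp_all add: x_def y_def)
  have "D > 0"
  proof (cases "P = 0")
    case True
    then show ?thesis using \<open>s > 0\<close> pos by (simp add: D_def s_def)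
  next
    case False
    then show ?thesis using pos by (simp add: D_def add_pos_nonneg)
  qed
  then show "C \<noteq> 0" using sC \<open>r \<noteq> 0\<close> by auto
  \<comment> \<open>The factor \<open>r\<close>, whose sign is unknown, cancels here, which leaves a
    positive denominator \<open>D\<close>.\<close>
  have quot: "(r * z) / C = s\<^sup>2 * z / D" for z
    using sC \<open>C \<noteq> 0\<close> \<open>D > 0\<close> by (simp add: field_simps)
  \<comment> \<open>Both bounds reduce to \<open>D \<le> s\<^sup>2 * y\<close> and
    \<open>D \<le> s\<^sup>2 * x\<close>; on the line the gaps factor into nonnegative
    products.\<close>
  have "s\<^sup>2 * y - D = 2 * Q * B * s" "s\<^sup>2 * x - D = 2 * P * A * s"
    using line unfolding s_def x_def y_def D_def by algebra+
  moreover have "0 \<le> 2 * Q * B * s" "0 \<le> 2 * P * A * s" using nonneg \<open>s > 0\<close> by simp_all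
  ultimately have "D \<le> s\<^sup>2 * y" "D \<le> s\<^sup>2 * x" by linarith+
  then show "1 \<le> k / C" "1 \<le> l / C" using \<open>D > 0\<close> unfolding k l quot by simp_all
qed

theorem theorem6:
  fixes M :: "'a measure" and N :: "'b measure"
    and X\<^sub>1 X\<^sub>2 Y\<^sub>u :: "'a \<Rightarrow> real" and Y\<^sub>0 :: "'b \<Rightarrow> real"
    and m\<^sub>1 m\<^sub>2 \<alpha> \<beta> \<alpha>\<^sub>u \<beta>\<^sub>u c :: real and B\<^sub>0 :: "(real \<times> real) set"
  defines "m\<^sub>1 \<equiv> prob_space.expectation M (\<lambda>\<omega>. X\<^sub>1 \<omega> ^ 4)"
    and "m\<^sub>2 \<equiv> prob_space.expectation M (\<lambda>\<omega>. X\<^sub>2 \<omega> ^ 4)"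
    and "\<alpha>\<^sub>u \<equiv> \<alpha> / norm (\<alpha>, \<beta>)"
    and "\<beta>\<^sub>u \<equiv> \<beta> / norm (\<alpha>, \<beta>)"
    and "Y\<^sub>u \<equiv> \<lambda>\<omega>. \<alpha>\<^sub>u * X\<^sub>1 \<omega> + \<beta>\<^sub>u * X\<^sub>2 \<omega>"
    and "B\<^sub>0 \<equiv> repr_coeffs M X\<^sub>1 X\<^sub>2 N Y\<^sub>0"
    and "c \<equiv> prob_space.expectation M (\<lambda>\<omega>. Y\<^sub>u \<omega> ^ 4)"
  assumes "prob_space M" and "prob_space N"
    and "prob_space.indep_var M borel X\<^sub>1 borel X\<^sub>2"
    and "prob_space.expectation M X\<^sub>1 = 0" and "prob_space.expectation M X\<^sub>2 = 0"
    and "prob_space.variance M X\<^sub>1 = 1" and "prob_space.variance M X\<^sub>2 = 1"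
    and "integrable M (\<lambda>\<omega>. X\<^sub>1 \<omega> ^ 4)" and "integrable M (\<lambda>\<omega>. X\<^sub>2 \<omega> ^ 4)"
    and "m\<^sub>1 \<noteq> 3 \<or> m\<^sub>2 \<noteq> 3"
    and "(\<alpha>, \<beta>) \<noteq> (0, 0)"
    and "eq_in_distr N Y\<^sub>0 M (\<lambda>\<omega>. \<alpha> * X\<^sub>1 \<omega> + \<beta> * X\<^sub>2 \<omega>)"
  shows "c = \<alpha>\<^sub>u ^ 4 * m\<^sub>1 + \<beta>\<^sub>u ^ 4 * m\<^sub>2 + 6 * \<alpha>\<^sub>u\<^sup>2 * \<beta>\<^sub>u\<^sup>2 \<and>
    (c = 3 \<longrightarrow> B\<^sub>0 \<subseteq> sign_changes \<alpha> \<beta>) \<and>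
    (c \<noteq> 3 \<longrightarrow>
       finite B\<^sub>0 \<and> card B\<^sub>0 \<le> 8 \<and>
       (let w\<^sub>1 = (m\<^sub>1 - 3) / (c - 3); w\<^sub>2 = (m\<^sub>2 - 3) / (c - 3)
        in min w\<^sub>1 w\<^sub>2 < 1 \<longrightarrow> B\<^sub>0 \<subseteq> sign_changes \<alpha> \<beta>))"
proof -
  interpret prob_space M by fact
  note mom = moments_linear_combination[OF assms(10-16), folded m\<^sub>1_def m\<^sub>2_def]
  define P Q k l C where "P = \<alpha>\<^sup>2" and "Q = \<beta>\<^sup>2" and "k = m\<^sub>1 - 3" and "l = m\<^sub>2 - 3" and "C = c - 3"
  have nonneg: "0 \<le> P" "0 \<le> Q" and s: "0 < P + Q"
    using assms(18) by (auto simp: P_def Q_def sum_power2_gt_zero_iff)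
  have nz: "k \<noteq> 0 \<or> l \<noteq> 0" using assms(17) by (auto simp: k_def l_def)
  have c: "c = \<alpha>\<^sub>u ^ 4 * m\<^sub>1 + \<beta>\<^sub>u ^ 4 * m\<^sub>2 + 6 * \<alpha>\<^sub>u\<^sup>2 * \<beta>\<^sub>u\<^sup>2"
    unfolding c_def Y\<^sub>u_def by (rule mom(2))
  \<comment> \<open>On the unit circle 3 equals three times the square of
    \<open>\<alpha>\<^sub>u\<^sup>2 + \<beta>\<^sub>u\<^sup>2\<close>, so subtracting it from
    \<open>c\<close> absorbs the mixed term; rescaling by \<open>n ^ 4 = (P + Q)\<^sup>2\<close>
    gives the claim.\<close>
  have C: "P\<^sup>2 * k + Q\<^sup>2 * l = (P + Q)\<^sup>2 * C"
  proof -
    define n where "n = norm (\<alpha>, \<beta>)"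
    have n2: "n\<^sup>2 = P + Q" by (simp add: n_def norm_Pair P_def Q_def)
    then have "n \<noteq> 0" using s by auto
    then have "\<alpha> = n * \<alpha>\<^sub>u" "\<beta> = n * \<beta>\<^sub>u" by (simp_all add: \<alpha>\<^sub>u_def \<beta>\<^sub>u_def n_def)
    then have PQ: "P = n\<^sup>2 * \<alpha>\<^sub>u\<^sup>2" "Q = n\<^sup>2 * \<beta>\<^sub>u\<^sup>2" by (simp_all add: P_def Q_def power_mult_distrib)
    then have "n\<^sup>2 * (\<alpha>\<^sub>u\<^sup>2 + \<beta>\<^sub>u\<^sup>2) = n\<^sup>2 * 1" using n2 by algebra
    then have unit: "\<alpha>\<^sub>u\<^sup>2 + \<beta>\<^sub>u\<^sup>2 = 1" using \<open>n \<noteq> 0\<close> by (subst (asm) mult_cancel_left) simp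
    then have "C = \<alpha>\<^sub>u ^ 4 * k + \<beta>\<^sub>u ^ 4 * l" unfolding C_def c k_def l_def by algebra
    then show ?thesis using unit unfolding PQ by algebra
  qed
  have B: "a\<^sup>2 + b\<^sup>2 = P + Q" "(a\<^sup>2)\<^sup>2 * k + (b\<^sup>2)\<^sup>2 * l = P\<^sup>2 * k + Q\<^sup>2 * l" if "(a, b) \<in> B\<^sub>0" for a b
  proof -
    have d: "eq_in_distr M (\<lambda>\<omega>. a * X\<^sub>1 \<omega> + b * X\<^sub>2 \<omega>) M (\<lambda>\<omega>. \<alpha> * X\<^sub>1 \<omega> + \<beta> * X\<^sub>2 \<omega>)"
      using that assms(19) eq_in_distr_trans unfolding B\<^sub>0_def repr_coeffs_def by blast
    have 2: "a\<^sup>2 + b\<^sup>2 = \<alpha>\<^sup>2 + \<beta>\<^sup>2"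
      using eq_in_distr_expectation[OF d, of "\<lambda>t. t\<^sup>2"] by (simp add: mom(1))
    have 4: "a ^ 4 * m\<^sub>1 + b ^ 4 * m\<^sub>2 + 6 * a\<^sup>2 * b\<^sup>2 = \<alpha> ^ 4 * m\<^sub>1 + \<beta> ^ 4 * m\<^sub>2 + 6 * \<alpha>\<^sup>2 * \<beta>\<^sup>2"
      using eq_in_distr_expectation[OF d, of "\<lambda>t. t ^ 4"] by (simp add: mom(2))
    show "a\<^sup>2 + b\<^sup>2 = P + Q" using 2 by (simp add: P_def Q_def)
    \<comment> \<open>Subtracting three times the square of the second moment identity from the
      fourth moment identity removes the mixed terms.\<close>
    show "(a\<^sup>2)\<^sup>2 * k + (b\<^sup>2)\<^sup>2 * l = P\<^sup>2 * k + Q\<^sup>2 * l"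
      using 2 4 unfolding P_def Q_def k_def l_def by algebra
  qed
  \<comment> \<open>On the line the first square determines the second, so
    \<open>a\<^sup>2 = P\<close> would already make the point a sign change.\<close>
  have out: "a\<^sup>2 \<noteq> P" if "(a, b) \<in> B\<^sub>0" "(a, b) \<notin> sign_changes \<alpha> \<beta>" for a b
    using that B(1)[OF that(1)] by (auto simp: mem_sign_changes_iff P_def Q_def)
  \<comment> \<open>A single point outside the sign changes yields all three facts. The
    contrapositive serves both inclusions: \<open>c = 3\<close> contradicts the first, a weight
    below 1 one of the others.\<close>
  have weights: "C \<noteq> 0 \<and> 1 \<le> k / C \<and> 1 \<le> l / C" if nsub: "\<not> B\<^sub>0 \<subseteq> sign_changes \<alpha> \<beta>"
  proof -
    obtain a b where ab: "(a, b) \<in> B\<^sub>0" "(a, b) \<notin> sign_changes \<alpha> \<beta>" using nsub by (meson subrelI)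
    show ?thesis
      using line_conic_weights[OF _ _ nonneg B(1)[OF ab(1)] s B(2)[OF ab(1)] C out[OF ab] nz] by simp
  qed
  \<comment> \<open>All points outside the first family share one pair of squares, so a single
    further family contains them. Each family has at most four members, whence the bound 8.\<close>
  have "\<exists>a b. B\<^sub>0 \<subseteq> sign_changes \<alpha> \<beta> \<union> sign_changes a b"
  proof (cases "B\<^sub>0 \<subseteq> sign_changes \<alpha> \<beta>")
    case False
    then obtain a b where ab: "(a, b) \<in> B\<^sub>0" "(a, b) \<notin> sign_changes \<alpha> \<beta>" by (meson subrelI)
    have "(a', b') \<in> sign_changes a b" if ab': "(a', b') \<in> B\<^sub>0" "(a', b') \<notin> sign_changes \<alpha> \<beta>" for a' b'
    proof -
      have "a'\<^sup>2 = a\<^sup>2"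
        using line_conic_three_points[OF B(1)[OF ab'(1)] B(1)[OF ab(1)] _ B(2)[OF ab'(1)]
            B(2)[OF ab(1)] out[OF ab'] out[OF ab] nz] s by simp
      then show ?thesis using B(1)[OF ab'(1)] B(1)[OF ab(1)] by (simp add: mem_sign_changes_iff)
    qed
    then have "B\<^sub>0 \<subseteq> sign_changes \<alpha> \<beta> \<union> sign_changes a b" by (meson UnCI subrelI)
    then show ?thesis by blast
  qed blast
  then obtain a b where sub: "B\<^sub>0 \<subseteq> sign_changes \<alpha> \<beta> \<union> sign_changes a b" by blast
  have "card B\<^sub>0 \<le> card (sign_changes \<alpha> \<beta> \<union> sign_changes a b)"
    using sub by (intro card_mono) (simp_all add: finite_sign_changes)
  also have "\<dots> \<le> card (sign_changes \<alpha> \<beta>) + card (sign_changes a b)"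
    by (rule card_Un_le)
  also have "\<dots> \<le> 8"
    using card_sign_changes_le[of \<alpha> \<beta>] card_sign_changes_le[of a b] by linarith
  finally have "card B\<^sub>0 \<le> 8" .
  moreover have "finite B\<^sub>0"
    using sub finite_subset by (blast intro: finite_sign_changes)
  moreover have "B\<^sub>0 \<subseteq> sign_changes \<alpha> \<beta>" if "c = 3"
    using weights that unfolding C_def by force
  moreover have "B\<^sub>0 \<subseteq> sign_changes \<alpha> \<beta>" if "min ((m\<^sub>1 - 3) / (c - 3)) ((m\<^sub>2 - 3) / (c - 3)) < 1"
    using weights that unfolding C_def k_def l_def by (meson min_less_iff_disj not_less)
  ultimately show ?thesis
    using c unfolding Let_def by blast
qed

end
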